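(* Let $\tilde u\in\mathbb R^n$ with $\tilde u\neq 0$, and let $T\in\mathbb R^{n\times n}$ be a circulant matrix. Write $T=\mathcal F^{-1}\Lambda\mathcal F$ with $\mathcal F$ the unitary discrete Fourier transform and $\Lambda=\mathrm{diag}(\gamma_0,\dots,\gamma_{n-1})$, let $\hat u=\mathcal F\tilde u$ and $B(\lambda)=(I+\lambda|\Lambda|^2)^{-1}$, and define $$f(\lambda;\tilde u,T)=\lambda\,\frac{\||\Lambda|^2B(\lambda)\hat u\|_2^2}{\||\Lambda|B(\lambda)\hat u\|_2^2}\,\frac{\mathrm{trace}(B(\lambda))}{\mathrm{trace}(|\Lambda|^2B(\lambda))}.$$ Then $f$ satisfies: 1. For $T=I$, $f(\lambda;\tilde u,I)=\lambda$ and every real number is a fixed point. 2. Zero is a fixed point of $f$. Moreover, zero is a stable fixed point if $$f'(0;\tilde u,T)=\frac{n}{\sum_{j=0}^{n-1}|\gamma_j|^2}\,\frac{\|T^{\mathsf T}T\tilde u\|_2^2}{\|T\tilde u\|_2^2}<1.$$ 3. For $T=T_r$ with $r>0$, the asymptotic behavior of $f$ as $\lambda\to\infty$ is given by $$f(\lambda;\tilde u,T_r)\sim\lambda^2\,\kappa_\infty(\tilde u,T_r),\qquad \kappa_\infty(\tilde u,T_r)=\frac{\sum_{j=1}^{n-1}|\hat u_j|^2}{(n-1)\sum_{j=1}^{n-1}|\hat u_j|^2/|\gamma_j|^2},$$ and $$\frac{4^r\sin^{2r}(\pi/n)}{n-1}\le\kappa_\infty(\tilde u,T_r)\le\frac{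4^r}{n-1}.$$
   Context: Indices run over $0,\dots,n-1$. The unitary discrete Fourier transform $\mathcal F$ has entries $\mathcal F_{jk}=n^{-1/2}e^{-2\pi i jk/n}$; it diagonalizes every circulant matrix, and $\gamma_j$ is the eigenvalue of $T$ for the $j$-th Fourier mode. $|\Lambda|$ is the diagonal matrix with entries $|\gamma_j|$, and superscript $\mathsf T$ denotes transpose. The matrix $T_1\in\mathbb R^{n\times n}$ is the circulant forward difference, $(T_1u)_k=u_{k+1}-u_k$ with indices modulo $n$, and $T_r=T_1^r$ is the circulant finite difference matrix of (integer) order $r$; its eigenvalues satisfy $|\gamma_j|^2=4^r\sin^{2r}(\pi j/n)$, $j=0,\dots,n-1$. The notation $f(\lambda)\sim g(\lambda)$ as $\lambda\to\infty$ means $f(\lambda)/g(\lambda)\to1$. The function $f$ is the map of the fixed point iteration $\lambda_{k+1}=f(\lambda_k;\tilde u,T)$; a fixed point $\lambda_*$ is called stable if this iteration converges to $\lambda_*$ for all starting values sufficiently close to $\lambda_*$.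
   Formalization: In part 1, λ=-1 is excluded because B(-1) does not exist for T=I; instead f is shown to have limit -1 there. Part 3 assumes T_r ũ≠0 (ũ not constant), since otherwise f and κ_∞ are 0/0. *)

theory Defs
  imports Complex_Main "Jordan_Normal_Form.Gauss_Jordan_Elimination" "Jordan_Normal_Form.Determinant"
begin

definition norm2 :: "'a::real_normed_vector vec \<Rightarrow> real" where
  "norm2 v = sqrt (\<Sum>i<dim_vec v. (norm (v $ i))\<^sup>2)"

definition mat_trace :: "'a::comm_monoid_add mat \<Rightarrow> 'a" where
  "mat_trace A = (\<Sum>i<dim_row A. A $$ (i, i))"

text \<open>The inverse of an invertible square matrix; unspecified for any other matrix.\<close>

definition mat_inv :: "'a::field mat \<Rightarrow> 'a mat" where
  "mat_inv A = the (mat_inverse A)"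

definition circulant :: "nat \<Rightarrow> 'a mat \<Rightarrow> bool" where
  "circulant n A \<longleftrightarrow> (\<exists>c. A = mat n n (\<lambda>(i, j). c ((j + n - i) mod n)))"

abbreviation cvec :: "real vec \<Rightarrow> complex vec" where
  "cvec \<equiv> map_vec complex_of_real"

abbreviation cmat :: "real mat \<Rightarrow> complex mat" where
  "cmat \<equiv> map_mat complex_of_real"

definition dft :: "nat \<Rightarrow> complex mat" where
  "dft n = mat n n (\<lambda>(j, k).
     exp (- 2 * complex_of_real pi * \<i> * of_nat j * of_nat k / of_nat n) / complex_of_real (sqrt (real n)))"

definition dft_vec :: "nat \<Rightarrow> real vec \<Rightarrow> complex vec" where
  "dft_vec n u = dft n *\<^sub>v cvec u"

text \<open>For circulant \<open>T\<close> the matrix \<open>dft n * T * (dft n)\<^sup>-\<^sup>1\<close> is diagonal, and its \<open>j\<close>-th diagonal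
  entry is the eigenvalue of \<open>T\<close> for the \<open>j\<close>-th Fourier mode (the \<open>j\<close>-th column of the inverse
  transform); see \<open>circulant_dft_decomposition\<close> below.\<close>

definition dft_eigval :: "nat \<Rightarrow> real mat \<Rightarrow> nat \<Rightarrow> complex" where
  "dft_eigval n T j = (dft n * cmat T * mat_inv (dft n)) $$ (j, j)"

definition Lam :: "nat \<Rightarrow> real mat \<Rightarrow> complex mat" where
  "Lam n T = mat_diag n (dft_eigval n T)"

definition abs_Lam :: "nat \<Rightarrow> real mat \<Rightarrow> real mat" where
  "abs_Lam n T = mat_diag n (\<lambda>j. cmod (dft_eigval n T j))"

definition B_mat :: "nat \<Rightarrow> real mat \<Rightarrow> real \<Rightarrow> real mat" where
  "B_mat n T l = mat_inv (1\<^sub>m n + l \<cdot>\<^sub>m (abs_Lam n T ^\<^sub>m 2))"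

definition fp_map :: "nat \<Rightarrow> real vec \<Rightarrow> real mat \<Rightarrow> real \<Rightarrow> real" where
  "fp_map n u T l =
     l * ((norm2 (cmat (abs_Lam n T ^\<^sub>m 2 * B_mat n T l) *\<^sub>v dft_vec n u))\<^sup>2 /
          (norm2 (cmat (abs_Lam n T * B_mat n T l) *\<^sub>v dft_vec n u))\<^sup>2)
       * (mat_trace (B_mat n T l) / mat_trace (abs_Lam n T ^\<^sub>m 2 * B_mat n T l))"

definition fixed_point :: "('a \<Rightarrow> 'a) \<Rightarrow> 'a \<Rightarrow> bool" where
  "fixed_point g x \<longleftrightarrow> g x = x"

definition stable_fixed_point :: "('a::topological_space \<Rightarrow> 'a) \<Rightarrow> 'a \<Rightarrow> bool" where
  "stable_fixed_point g x \<longleftrightarrow>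
     fixed_point g x \<and> (\<forall>\<^sub>F y in nhds x. (\<lambda>k. (g ^^ k) y) \<longlonglongrightarrow> x)"

definition fwd_diff :: "nat \<Rightarrow> real mat" where
  "fwd_diff n = mat n n (\<lambda>(k, l). (if l = (k + 1) mod n then 1 else 0) - (if l = k then 1 else 0))"

definition fin_diff :: "nat \<Rightarrow> nat \<Rightarrow> real mat" where
  "fin_diff n r = fwd_diff n ^\<^sub>m r"

definition kappa_inf :: "nat \<Rightarrow> real vec \<Rightarrow> real mat \<Rightarrow> real" where
  "kappa_inf n u T =
     (\<Sum>j=1..<n. (cmod (dft_vec n u $ j))\<^sup>2) /
     ((real n - 1) * (\<Sum>j=1..<n. (cmod (dft_vec n u $ j))\<^sup>2 / (cmod (dft_eigval n T j))\<^sup>2))"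

definition idft :: "nat \<Rightarrow> complex mat" where
  "idft n = mat n n (\<lambda>(j, k).
     exp (2 * complex_of_real pi * \<i> * of_nat j * of_nat k / of_nat n) / complex_of_real (sqrt (real n)))"

lemma dft_carrier [simp]: "dft n \<in> carrier_mat n n"
  by (simp add: dft_def)

lemma idft_carrier [simp]: "idft n \<in> carrier_mat n n"
  by (simp add: idft_def)

lemma exp_root_unity_cis:
  "exp (2 * complex_of_real pi * \<i> * of_nat j * of_nat k / of_nat n) = cis (2 * pi * real j / real n) ^ k"
  "exp (- 2 * complex_of_real pi * \<i> * of_nat j * of_nat k / of_nat n) = inverse (cis (2 * pi * real j / real n)) ^ k"
proof -
  show 1: "exp (2 * complex_of_real pi * \<i> * of_nat j * of_nat k / of_nat n) = cis (2 * pi * real j / real n) ^ k"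
    by (simp add: cis_conv_exp exp_of_nat_mult [symmetric] field_simps)
  have "exp (- 2 * complex_of_real pi * \<i> * of_nat j * of_nat k / of_nat n) =
      inverse (exp (2 * complex_of_real pi * \<i> * of_nat j * of_nat k / of_nat n))"
    by (simp add: exp_minus [symmetric])
  then show "exp (- 2 * complex_of_real pi * \<i> * of_nat j * of_nat k / of_nat n) = inverse (cis (2 * pi * real j / real n)) ^ k"
    using 1 by (simp only: power_inverse)
qed

lemma dft_idft:
  assumes "n > 0"
  shows "dft n * idft n = 1\<^sub>m n"
proof (rule eq_matI)
  fix j l assume "j < dim_row (1\<^sub>m n)" "l < dim_col (1\<^sub>m n)"
  then have jl: "j < n" "l < n" by auto
  define z where "z = cis (2 * pi * real l / real n) / cis (2 * pi * real j / real n)"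
  have u: "cis (2 * pi * real m / real n) ^ n = 1" for m
    using \<open>n > 0\<close> by (simp add: DeMoivre cis_multiple_2pi)
  have zn: "z ^ n = 1"
    by (simp add: z_def power_divide u)
  have sq: "complex_of_real (sqrt (real n)) * complex_of_real (sqrt (real n)) = of_nat n"
    by (simp flip: of_real_mult)
  have "(dft n * idft n) $$ (j, l) = (\<Sum>k<n. z ^ k / of_nat n)"
  proof -
    have "(dft n * idft n) $$ (j, l) = (\<Sum>k<n. dft n $$ (j, k) * idft n $$ (k, l))"
      using jl by (simp add: dft_def idft_def scalar_prod_def atLeast0LessThan)
    also have "\<dots> = (\<Sum>k<n. z ^ k / of_nat n)"
    proof (rule sum.cong)
      fix k assume "k \<in> {..<n}"
      then have k: "k < n" by simp
      have "dft n $$ (j, k) = inverse (cis (2 * pi * real j / real n)) ^ k / complex_of_real (sqrt (real n))"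
        using jl k unfolding dft_def by (simp add: exp_root_unity_cis(2) [simplified])
      moreover have "idft n $$ (k, l) = cis (2 * pi * real l / real n) ^ k / complex_of_real (sqrt (real n))"
        using jl k exp_root_unity_cis(1) [of l k n] unfolding idft_def by (simp add: mult_ac)
      ultimately show "dft n $$ (j, k) * idft n $$ (k, l) = z ^ k / of_nat n"
        by (simp add: z_def sq power_divide power_inverse divide_inverse mult_ac power_mult_distrib
            flip: inverse_mult_distrib)
    qed simp
    finally show ?thesis .
  qed
  also have "\<dots> = (\<Sum>k<n. z ^ k) / of_nat n"
    by (simp add: sum_divide_distrib)
  also have "\<dots> = 1\<^sub>m n $$ (j, l)"
  proof (cases "j = l")
    case True
    then show ?thesis using jl \<open>n > 0\<close> by (simp add: z_def)
  next
    case False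
    have "inj_on (\<lambda>k. cis (2 * pi * real k / real n)) {..<n}"
      using bij_betw_roots_unity [OF \<open>n > 0\<close>] by (simp add: bij_betw_def)
    with False jl have "cis (2 * pi * real l / real n) \<noteq> cis (2 * pi * real j / real n)"
      by (auto dest: inj_onD)
    then have "z \<noteq> 1" by (simp add: z_def)
    then have "(\<Sum>k<n. z ^ k) = 0"
      using zn by (simp add: geometric_sum)
    then show ?thesis using False jl by simp
  qed
  finally show "(dft n * idft n) $$ (j, l) = 1\<^sub>m n $$ (j, l)" .
qed (auto simp: dft_def idft_def)

lemma mat_inv_eqI:
  fixes A :: "'a::field mat"
  assumes A: "A \<in> carrier_mat n n" and C: "C \<in> carrier_mat n n" and AC: "A * C = 1\<^sub>m n"
  shows "mat_inv A = C"
proof -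
  have CA: "C * A = 1\<^sub>m n"
    using mat_mult_left_right_inverse [OF A C AC] .
  then have "A \<in> Units (ring_mat TYPE('a) n ())"
    using A C AC by (auto simp: Units_def ring_mat_def)
  then obtain D where D: "mat_inverse A = Some D"
    using mat_inverse(1) [OF A, where b = "()"] by (cases "mat_inverse A") auto
  from mat_inverse(2) [OF A D] have D': "A * D = 1\<^sub>m n" "D \<in> carrier_mat n n" by auto
  have "D = C * A * D"
    using CA D' by simp
  also have "\<dots> = C"
    using assoc_mult_mat [OF C A D'(2)] D' C by simp
  finally show ?thesis
    using D by (simp add: mat_inv_def)
qed

lemma mat_inv_dft: "n > 0 \<Longrightarrow> mat_inv (dft n) = idft n"
  by (rule mat_inv_eqI [of _ n]) (simp_all add: dft_idft)

theorem circulant_dft_decomposition: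
  assumes n: "n > 0" and T: "circulant n T"
  shows "cmat T = mat_inv (dft n) * Lam n T * dft n"
proof -
  obtain c where c: "T = mat n n (\<lambda>(i, j). c ((j + n - i) mod n))"
    using T by (auto simp: circulant_def)
  have Tc: "cmat T \<in> carrier_mat n n" by (simp add: c)
  define w where "w = (\<lambda>j. cis (2 * pi * real j / real n))"
  have wn: "w j ^ n = 1" for j
    using n by (simp add: w_def DeMoivre cis_multiple_2pi)
  have w0: "w j \<noteq> 0" for j by (simp add: w_def)
  define g where "g = (\<lambda>j. \<Sum>m<n. complex_of_real (c m) * w j ^ m)"
  have dft_w: "dft n $$ (j, k) = inverse (w j) ^ k / complex_of_real (sqrt (real n))" if "j < n" "k < n" for j k
    using that unfolding dft_def w_def by (simp add: exp_root_unity_cis(2) [simplified])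
  have "dft n * cmat T = mat_diag n g * dft n"
  proof (rule eq_matI)
    fix j l assume "j < dim_row (mat_diag n g * dft n)" "l < dim_col (mat_diag n g * dft n)"
    then have jl: "j < n" "l < n" by (auto simp: mat_diag_def dft_def)
    have inv_w: "inverse (w j) ^ k = inverse (w j) ^ l * w j ^ ((l + n - k) mod n)" if "k < n" for k
    proof -
      have "w j ^ (l + n - k) = w j ^ ((l + n - k) mod n)"
        by (metis mod_mult_div_eq mult.right_neutral power_add power_mult power_one wn)
      moreover have "w j ^ k * w j ^ (l + n - k) = w j ^ l"
        using that jl by (simp add: wn flip: power_add) (simp add: power_add wn)
      ultimately have "w j ^ k * w j ^ ((l + n - k) mod n) = w j ^ l" by simp
      then show ?thesis using w0 [of j] by (simp add: power_inverse field_simps)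
    qed
    have bij: "bij_betw (\<lambda>k. (l + n - k) mod n) {..<n} {..<n}"
    proof (rule bij_betwI [where g = "\<lambda>k. (l + n - k) mod n"])
      have "(l + n - (l + n - k) mod n) mod n = k" if "k < n" for k
      proof (cases "k \<le> l")
        case True
        then have "(l + n - k) mod n = l - k" using jl
          by (metis Nat.add_diff_assoc2 less_imp_diff_less mod_add_self2 mod_less)
        then show ?thesis using True that by simp
      next
        case False
        then have "(l + n - k) mod n = l + n - k" using that by simp
        then show ?thesis using that False by simp
      qed
      then show "\<And>x. x \<in> {..<n} \<Longrightarrow> (l + n - (l + n - x) mod n) mod n = x"
        "\<And>x. x \<in> {..<n} \<Longrightarrow> (l + n - (l + n - x) mod n) mod n = x" by auto
    qed (use n in auto)
    have "(dft n * cmat T) $$ (j, l) = (\<Sum>k<n. dft n $$ (j, k) * complex_of_real (T $$ (k, l)))"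
      using jl Tc c by (simp add: dft_def scalar_prod_def atLeast0LessThan)
    also have "\<dots> = (\<Sum>k<n. dft n $$ (j, l) * (complex_of_real (c ((l + n - k) mod n)) * w j ^ ((l + n - k) mod n)))"
    proof (rule sum.cong)
      fix k assume "k \<in> {..<n}"
      then have k: "k < n" by simp
      have "T $$ (k, l) = c ((l + n - k) mod n)" using k jl by (simp add: c)
      then show "dft n $$ (j, k) * complex_of_real (T $$ (k, l)) =
          dft n $$ (j, l) * (complex_of_real (c ((l + n - k) mod n)) * w j ^ ((l + n - k) mod n))"
        by (simp only: dft_w [OF jl(1) k] dft_w [OF jl] inv_w [OF k]) simp
    qed simp
    also have "\<dots> = dft n $$ (j, l) * g j"
      unfolding g_def sum_distrib_left [symmetric]
      by (subst sum.reindex_bij_betw [OF bij, where g = "\<lambda>m. complex_of_real (c m) * w j ^ m"]) simp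
    also have "\<dots> = (mat_diag n g * dft n) $$ (j, l)"
      using jl by (simp add: mat_diag_mult_left [OF dft_carrier])
    finally show "(dft n * cmat T) $$ (j, l) = (mat_diag n g * dft n) $$ (j, l)" .
  qed (auto simp: dft_def mat_diag_def c)
  then have "dft n * cmat T * idft n = mat_diag n g"
    using dft_idft [OF n] assoc_mult_mat [OF mat_diag_dim [of n g] dft_carrier idft_carrier]
    by (simp add: right_mult_one_mat [OF mat_diag_dim [of n g]])
  then have eig: "dft_eigval n T j = g j" if "j < n" for j
    using that by (simp add: dft_eigval_def mat_inv_dft [OF n] mat_diag_def)
  then have Lam: "Lam n T = mat_diag n g"
    by (auto simp: Lam_def mat_diag_def intro!: eq_matI)
  have inv: "idft n * dft n = 1\<^sub>m n"
    by (rule mat_mult_left_right_inverse [OF dft_carrier idft_carrier dft_idft [OF n]])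
  have "mat_inv (dft n) * Lam n T * dft n = idft n * (dft n * cmat T)"
    using \<open>dft n * cmat T = mat_diag n g * dft n\<close> assoc_mult_mat [OF idft_carrier mat_diag_dim [of n g] dft_carrier]
    by (simp add: mat_inv_dft [OF n] Lam)
  also have "\<dots> = cmat T"
    using assoc_mult_mat [OF idft_carrier dft_carrier Tc] inv Tc by simp
  finally show ?thesis by simp
qed

end

theory Submission
  imports Defs
begin

text \<open>Apart from the Fourier transform of \<open>u\<close>, the map \<open>f\<close> is built from diagonal matrices, so \<open>f\<close> depends on the data only
through the squared eigenvalue moduli \<open>w\<^sub>j = |\<gamma>\<^sub>j|\<^sup>2\<close> and the energies \<open>a\<^sub>j = |(F u)\<^sub>j|\<^sup>2\<close>:
wherever no \<open>1 + \<lambda> w\<^sub>j\<close> vanishes it is the rational function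
\<open>\<lambda> \<cdot> (\<Sum> w\<^sub>j\<^sup>2 a\<^sub>j / (1 + \<lambda> w\<^sub>j)\<^sup>2) / (\<Sum> w\<^sub>j a\<^sub>j / (1 + \<lambda> w\<^sub>j)\<^sup>2) \<cdot> (\<Sum> 1 / (1 + \<lambda> w\<^sub>j)) / (\<Sum> w\<^sub>j / (1 + \<lambda> w\<^sub>j))\<close>
(\<open>fp_map_eq_spectral_map\<close>). The three claims are then calculus.

For \<open>T = I\<close> all \<open>w\<^sub>j\<close> equal \<open>1\<close> and both quotients cancel down to \<open>\<lambda>\<close>.

If \<open>T u = 0\<close>, then \<open>f\<close> vanishes near \<open>0\<close>. Otherwise the function has the form \<open>\<lambda> g(\<lambda>)\<close> with \<open>g\<close> continuous
at \<open>0\<close>, so its derivative there is \<open>g(0)\<close>; Parseval's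
identity and the fact that transposition conjugates the eigenvalues of a real matrix diagonalized by the
transform turn the sums in \<open>g(0)\<close> into the norms of \<open>T u\<close> and \<open>T\<^sup>T T u\<close>
(\<open>fp_map_deriv_zero\<close>). This derivative is nonnegative, so if it is less than \<open>1\<close> the map contracts
towards \<open>0\<close> near \<open>0\<close> (\<open>stable_fixed_point_of_deriv\<close>).

For \<open>T = T\<^sub>r\<close> exactly the constant mode \<open>j = 0\<close> lies in the kernel. As \<open>\<lambda>\<close> grows,
\<open>\<lambda> w\<^sub>j / (1 + \<lambda> w\<^sub>j)\<close> tends to \<open>1\<close> for every other mode, while the trace of the resolvent tends to the
contribution \<open>1\<close> of the kernel; this is where the second power of \<open>\<lambda>\<close> comes from
(\<open>spectral_map_asymptotics\<close>). Up to the factor \<open>n - 1\<close>, the limiting constant is the harmonic mean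
of the \<open>w\<^sub>j\<close>, \<open>j \<noteq> 0\<close>, weighted by the \<open>a\<^sub>j\<close>, and hence lies between the bounds
\<open>4\<^sup>r sin\<^sup>2\<^sup>r(\<pi>/n)\<close> and \<open>4\<^sup>r\<close> on these eigenvalues (\<open>harmonic_mean_bounds\<close>). If \<open>T\<^sub>r u \<noteq> 0\<close>, then some
\<open>a\<^sub>j\<close> with \<open>j \<noteq> 0\<close> is positive and these quotients are genuine.\<close>

section \<open>Diagonalization by the discrete Fourier transform\<close>

lemma mat_diag_pow: "mat_diag n f ^\<^sub>m r = mat_diag n (\<lambda>j. f j ^ r)"
proof (induction r)
  case 0
  show ?case by (simp add: mat_diag_def[of n f])
next
  case (Suc r)
  then show ?case by (simp add: power_Suc2 del: power_Suc)
qed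

lemma mat_diag_mult_vec:
  assumes "v \<in> carrier_vec n" "j < n"
  shows "(mat_diag n f *\<^sub>v v) $ j = f j * v $ j"
proof -
  have "(mat_diag n f *\<^sub>v v) $ j = (\<Sum>k<n. (if j = k then f k else 0) * v $ k)"
    using assms by (simp add: mat_diag_def scalar_prod_def atLeast0LessThan)
  also have "\<dots> = (\<Sum>k<n. if j = k then f k * v $ k else 0)"
    by (rule sum.cong) auto
  finally show ?thesis using assms by simp
qed

lemma idft_dft: "n > 0 \<Longrightarrow> idft n * dft n = 1\<^sub>m n"
  by (rule mat_mult_left_right_inverse [OF dft_carrier idft_carrier dft_idft])

lemma cnj_dft:
  assumes "j < n" "k < n"
  shows "cnj (dft n $$ (j, k)) = idft n $$ (k, j)"
proof -
  have "dft n $$ (j, k) = inverse (cis (2 * pi * real j / real n)) ^ k / complex_of_real (sqrt (real n))"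
    using assms exp_root_unity_cis(2)[of j k n] by (simp add: dft_def)
  moreover have "idft n $$ (k, j) = cis (2 * pi * real j / real n) ^ k / complex_of_real (sqrt (real n))"
    using assms exp_root_unity_cis(1)[of j k n] by (simp add: idft_def mult_ac)
  ultimately show ?thesis by (simp add: cis_cnj)
qed

text \<open>The conjugate transpose of the transform is its inverse, so pairing the transform of \<open>v\<close> with its
conjugate lets the two transforms cancel.\<close>

lemma dft_parseval:
  assumes v: "v \<in> carrier_vec n" and n: "n > 0"
  shows "(\<Sum>j<n. (cmod ((dft n *\<^sub>v v) $ j))\<^sup>2) = (\<Sum>j<n. (cmod (v $ j))\<^sup>2)"
proof -
  define x where "x = dft n *\<^sub>v v"
  have xc: "x \<in> carrier_vec n" unfolding x_def by (rule mult_mat_vec_carrier[OF dft_carrier v])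
  have xj: "x $ j = (\<Sum>k<n. dft n $$ (j, k) * v $ k)" if "j < n" for j
    using that v by (simp add: x_def dft_def scalar_prod_def atLeast0LessThan)
  have "idft n *\<^sub>v x = (idft n * dft n) *\<^sub>v v"
    unfolding x_def by (rule assoc_mult_mat_vec[symmetric, OF idft_carrier dft_carrier v])
  then have inversion: "idft n *\<^sub>v x = v"
    using v by (simp add: idft_dft[OF n])
  have vk: "v $ k = (\<Sum>j<n. idft n $$ (k, j) * x $ j)" if "k < n" for k
  proof -
    have "v $ k = (idft n *\<^sub>v x) $ k" by (simp add: inversion)
    also have "\<dots> = (\<Sum>j<n. idft n $$ (k, j) * x $ j)"
      using that xc by (simp add: idft_def scalar_prod_def atLeast0LessThan)
    finally show ?thesis .
  qed
  have "complex_of_real (\<Sum>j<n. (cmod (x $ j))\<^sup>2) = (\<Sum>j<n. cnj (x $ j) * x $ j)"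
    by (simp add: complex_norm_square mult.commute del: of_real_power)
  also have "\<dots> = (\<Sum>j<n. \<Sum>k<n. cnj (v $ k) * (idft n $$ (k, j) * x $ j))"
    by (rule sum.cong) (auto simp: xj cnj_dft sum_distrib_left sum_distrib_right mult_ac)
  also have "\<dots> = (\<Sum>k<n. cnj (v $ k) * v $ k)"
    by (subst sum.swap) (auto simp: vk sum_distrib_left intro!: sum.cong)
  also have "\<dots> = complex_of_real (\<Sum>k<n. (cmod (v $ k))\<^sup>2)"
    by (simp add: complex_norm_square mult.commute del: of_real_power)
  finally show ?thesis unfolding x_def of_real_eq_iff .
qed

lemma dft_vec_carrier [simp]: "dft_vec n v \<in> carrier_vec n"
  unfolding dft_vec_def by (rule carrier_vecI) (simp add: dft_def)

lemma norm2_dft_vec: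
  assumes "v \<in> carrier_vec n" "n > 0"
  shows "(norm2 v)\<^sup>2 = (\<Sum>j<n. (cmod (dft_vec n v $ j))\<^sup>2)"
  using assms dft_parseval[of "cvec v" n]
  by (simp add: norm2_def dft_vec_def sum_nonneg)

text \<open>Eigenvalues are most easily found by letting \<open>T\<close> act on the Fourier modes, the columns of the inverse
transform; this identifies them with \<^const>\<open>dft_eigval\<close>.\<close>

lemma dft_eigval_eqI:
  assumes n: "n > 0" and T: "T \<in> carrier_mat n n"
    and eq: "cmat T * idft n = idft n * mat_diag n g" and j: "j < n"
  shows "dft_eigval n T j = g j"
proof -
  have "dft n * cmat T * mat_inv (dft n) = dft n * (cmat T * idft n)"
    using T by (simp add: mat_inv_dft[OF n] assoc_mult_mat[OF dft_carrier _ idft_carrier])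
  also have "\<dots> = dft n * idft n * mat_diag n g"
    unfolding eq by (rule assoc_mult_mat[symmetric, OF dft_carrier idft_carrier mat_diag_dim])
  also have "\<dots> = mat_diag n g"
    by (simp add: dft_idft[OF n] left_mult_one_mat[OF mat_diag_dim])
  finally show ?thesis using j by (simp add: dft_eigval_def mat_diag_def)
qed

lemma diagonalized_by_dft:
  assumes n: "n > 0" and T: "T \<in> carrier_mat n n"
    and eq: "cmat T * idft n = idft n * mat_diag n g"
  shows "cmat T = idft n * mat_diag n (dft_eigval n T) * dft n"
proof -
  have Tc: "cmat T \<in> carrier_mat n n" using T by simp
  have g: "mat_diag n g = mat_diag n (dft_eigval n T)"
    by (rule eq_matI) (auto simp: mat_diag_def dft_eigval_eqI[OF n T eq])
  have "cmat T = cmat T * (idft n * dft n)"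
    using Tc by (simp add: idft_dft[OF n])
  also have "\<dots> = cmat T * idft n * dft n"
    by (rule assoc_mult_mat[symmetric, OF Tc idft_carrier dft_carrier])
  finally show ?thesis by (simp add: eq g)
qed

lemma dft_vec_diagonalized:
  assumes n: "n > 0" and T: "T \<in> carrier_mat n n" and v: "v \<in> carrier_vec n"
    and eq: "cmat T = idft n * mat_diag n g * dft n" and j: "j < n"
  shows "dft_vec n (T *\<^sub>v v) $ j = g j * dft_vec n v $ j"
proof -
  have vc: "cvec v \<in> carrier_vec n" using v by simp
  have Tc: "cmat T \<in> carrier_mat n n" using T by simp
  have D: "mat_diag n g * dft n \<in> carrier_mat n n"
    by (rule mult_carrier_mat[OF mat_diag_dim dft_carrier])
  have "dft n * cmat T = dft n * (idft n * (mat_diag n g * dft n))"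
    unfolding eq by (simp add: assoc_mult_mat[OF idft_carrier mat_diag_dim dft_carrier])
  also have "\<dots> = dft n * idft n * (mat_diag n g * dft n)"
    by (rule assoc_mult_mat[symmetric, OF dft_carrier idft_carrier D])
  also have "\<dots> = mat_diag n g * dft n"
    by (simp add: dft_idft[OF n] left_mult_one_mat[OF D])
  finally have *: "dft n * cmat T = mat_diag n g * dft n" .
  have "dft_vec n (T *\<^sub>v v) = dft n *\<^sub>v (cmat T *\<^sub>v cvec v)"
    by (simp add: dft_vec_def of_real_hom.mult_mat_vec_hom[OF T v])
  also have "\<dots> = (dft n * cmat T) *\<^sub>v cvec v"
    by (rule assoc_mult_mat_vec[symmetric, OF dft_carrier Tc vc])
  also have "\<dots> = mat_diag n g *\<^sub>v dft_vec n v"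
    unfolding * dft_vec_def by (rule assoc_mult_mat_vec[OF mat_diag_dim dft_carrier vc])
  finally show ?thesis using j by (simp add: mat_diag_mult_vec)
qed

text \<open>Since \<open>T\<close> is real, its transpose is its adjoint; taking adjoints swaps the transform with its inverse and
conjugates the eigenvalues.\<close>

lemma transpose_diagonalized_by_dft:
  assumes T: "T \<in> carrier_mat n n"
    and eq: "cmat T = idft n * mat_diag n g * dft n"
  shows "cmat (transpose_mat T) = idft n * mat_diag n (\<lambda>j. cnj (g j)) * dft n"
proof (rule eq_matI)
  have entry: "(idft n * mat_diag n h * dft n) $$ (i, j)
      = (\<Sum>k<n. idft n $$ (i, k) * h k * dft n $$ (k, j))" if "i < n" "j < n" for h i j
    using that unfolding mat_diag_mult_right[OF idft_carrier]
    by (simp add: scalar_prod_def atLeast0LessThan dft_def)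
  have cnj_idft: "cnj (idft n $$ (j, k)) = dft n $$ (k, j)" if "j < n" "k < n" for j k
    using cnj_dft[OF that(2,1)] by (metis complex_cnj_cnj)
  fix i j assume "i < dim_row (idft n * mat_diag n (\<lambda>j. cnj (g j)) * dft n)"
    "j < dim_col (idft n * mat_diag n (\<lambda>j. cnj (g j)) * dft n)"
  then have ij: "i < n" "j < n" by (auto simp: idft_def dft_def)
  have "cmat (transpose_mat T) $$ (i, j) = cnj (cmat T $$ (j, i))"
    using T ij by simp
  also have "\<dots> = (\<Sum>k<n. idft n $$ (i, k) * cnj (g k) * dft n $$ (k, j))"
    unfolding eq using ij by (simp add: entry cnj_dft cnj_idft mult_ac)
  finally show "cmat (transpose_mat T) $$ (i, j)
      = (idft n * mat_diag n (\<lambda>j. cnj (g j)) * dft n) $$ (i, j)"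
    using ij by (simp add: entry)
qed (use T in \<open>auto simp: idft_def dft_def\<close>)

lemma norm2_diagonalized:
  assumes n: "n > 0" and T: "T \<in> carrier_mat n n" and v: "v \<in> carrier_vec n"
    and eq: "cmat T = idft n * mat_diag n g * dft n"
  shows "(norm2 (T *\<^sub>v v))\<^sup>2 = (\<Sum>j<n. (cmod (g j))\<^sup>2 * (cmod (dft_vec n v $ j))\<^sup>2)"
proof -
  have "T *\<^sub>v v \<in> carrier_vec n" using T v by simp
  from norm2_dft_vec[OF this n] show ?thesis
    by (simp add: dft_vec_diagonalized[OF n T v eq] norm_mult power_mult_distrib)
qed

text \<open>Transposition changes only the phases of the eigenvalues, so \<open>T\<^sup>T T\<close> weights the \<open>j\<close>-th mode by
\<open>|\<gamma>\<^sub>j|\<^sup>2\<close>.\<close>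

lemma norm2_transpose_diagonalized:
  assumes n: "n > 0" and T: "T \<in> carrier_mat n n" and v: "v \<in> carrier_vec n"
    and eq: "cmat T = idft n * mat_diag n g * dft n"
  shows "(norm2 (transpose_mat T *\<^sub>v (T *\<^sub>v v)))\<^sup>2
    = (\<Sum>j<n. ((cmod (g j))\<^sup>2)\<^sup>2 * (cmod (dft_vec n v $ j))\<^sup>2)"
proof -
  have "T *\<^sub>v v \<in> carrier_vec n" "transpose_mat T \<in> carrier_mat n n" using T v by simp_all
  from norm2_diagonalized[OF n this(2,1) transpose_diagonalized_by_dft[OF T eq]] show ?thesis
    by (simp add: dft_vec_diagonalized[OF n T v eq] norm_mult power_mult_distrib power2_eq_square mult_ac)
qed

section \<open>The fixed point map as a rational function of the spectrum\<close>

text \<open>The fixed point map in Fourier coordinates: \<open>w j\<close> stands for the squared eigenvalue modulus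
\<open>|\<gamma>\<^sub>j|\<^sup>2\<close> and \<open>a j\<close> for the energy of the data in the \<open>j\<close>-th mode.\<close>

definition spectral_map :: "nat \<Rightarrow> (nat \<Rightarrow> real) \<Rightarrow> (nat \<Rightarrow> real) \<Rightarrow> real \<Rightarrow> real" where
  "spectral_map n w a l =
     l * ((\<Sum>j<n. (w j)\<^sup>2 * a j / (1 + l * w j)\<^sup>2) / (\<Sum>j<n. w j * a j / (1 + l * w j)\<^sup>2))
       * ((\<Sum>j<n. 1 / (1 + l * w j)) / (\<Sum>j<n. w j / (1 + l * w j)))"

lemma spectral_map_cong:
  assumes "\<And>j. j < n \<Longrightarrow> w j = w' j"
  shows "spectral_map n w a l = spectral_map n w' a l"
  unfolding spectral_map_def using assms by simp

text \<open>Away from the poles \<open>I + \<lambda>|\<Lambda>|\<^sup>2\<close> is an invertible diagonal matrix; its inverse and all the products in the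
map are then diagonal, and norms and traces become sums over modes. At a pole the matrix inverse is
unspecified, hence the hypothesis.\<close>

lemma fp_map_eq_spectral_map:
  assumes nz: "\<And>j. j < n \<Longrightarrow> 1 + l * (cmod (dft_eigval n T j))\<^sup>2 \<noteq> 0"
  shows "fp_map n u T l = spectral_map n (\<lambda>j. (cmod (dft_eigval n T j))\<^sup>2)
    (\<lambda>j. (cmod (dft_vec n u $ j))\<^sup>2) l"
proof -
  define m where "m = (\<lambda>j. cmod (dft_eigval n T j))"
  define b where "b = (\<lambda>j. 1 / (1 + l * (m j)\<^sup>2))"
  have sq: "abs_Lam n T ^\<^sub>m 2 = mat_diag n (\<lambda>j. (m j)\<^sup>2)"
    by (simp add: abs_Lam_def m_def mat_diag_pow)
  have resolvent: "1\<^sub>m n + l \<cdot>\<^sub>m mat_diag n (\<lambda>j. (m j)\<^sup>2) = mat_diag n (\<lambda>j. 1 + l * (m j)\<^sup>2)"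
    by (rule eq_matI) (auto simp: mat_diag_def)
  have B: "B_mat n T l = mat_diag n b"
    unfolding B_mat_def sq resolvent
  proof (rule mat_inv_eqI[OF mat_diag_dim mat_diag_dim])
    show "mat_diag n (\<lambda>j. 1 + l * (m j)\<^sup>2) * mat_diag n b = 1\<^sub>m n"
      unfolding mat_diag_diag using nz by (intro eq_matI) (auto simp: mat_diag_def b_def m_def)
  qed
  have norm: "(norm2 (cmat (mat_diag n d) *\<^sub>v dft_vec n u))\<^sup>2
      = (\<Sum>j<n. (d j)\<^sup>2 * (cmod (dft_vec n u $ j))\<^sup>2)" for d
  proof -
    have "cmat (mat_diag n d) = mat_diag n (\<lambda>j. complex_of_real (d j))"
      by (rule eq_matI) (auto simp: mat_diag_def)
    moreover have "dim_vec (mat_diag n (\<lambda>j. complex_of_real (d j)) *\<^sub>v dft_vec n u) = n"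
      by (simp add: mat_diag_def)
    ultimately show ?thesis
      by (simp add: norm2_def sum_nonneg mat_diag_mult_vec[OF dft_vec_carrier] norm_mult power_mult_distrib
          del: index_mult_mat_vec dim_mult_mat_vec)
  qed
  have trace: "mat_trace (mat_diag n d) = (\<Sum>j<n. d j)" for d :: "nat \<Rightarrow> real"
    by (simp add: mat_trace_def mat_diag_def)
  have AB: "abs_Lam n T * mat_diag n b = mat_diag n (\<lambda>j. m j * b j)"
    by (simp add: abs_Lam_def m_def)
  show ?thesis
    unfolding fp_map_def B sq AB mat_diag_diag norm trace spectral_map_def m_def[symmetric]
    by (simp add: b_def power_mult_distrib power_divide m_def)
qed

lemma spectral_map_one:
  assumes "l \<noteq> -1" "(\<Sum>j<n. a j) \<noteq> 0"
  shows "spectral_map n (\<lambda>_. 1) a l = l"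
proof -
  have "n \<noteq> 0" using assms by (intro notI) simp
  then show ?thesis
    using assms by (simp add: spectral_map_def add_eq_0_iff flip: sum_divide_distrib)
qed

text \<open>Writing the map as \<open>\<lambda> g(\<lambda>)\<close> with \<open>g\<close> continuous at \<open>0\<close>, the derivative is \<open>g(0)\<close>. If the data have no
energy outside the kernel (\<open>w\<^sub>j a\<^sub>j = 0\<close> for all \<open>j\<close>), the quotients have denominator zero, but then the
map and the claimed derivative both vanish under the convention \<open>x / 0 = 0\<close>.\<close>

lemma spectral_map_deriv_zero:
  assumes w: "\<And>j. j < n \<Longrightarrow> w j \<ge> 0" and a: "\<And>j. j < n \<Longrightarrow> a j \<ge> 0"
  shows "(spectral_map n w a has_real_derivative
    real n / (\<Sum>j<n. w j) * ((\<Sum>j<n. (w j)\<^sup>2 * a j) / (\<Sum>j<n. w j * a j))) (at 0)"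
proof (cases "(\<Sum>j<n. w j * a j) = 0")
  case True
  then have "w j * a j = 0" if "j < n" for j
    using that w a by (subst (asm) sum_nonneg_eq_0_iff) auto
  then have "(\<Sum>j<n. w j * a j / (1 + l * w j)\<^sup>2) = 0" for l
    by (intro sum.neutral) auto
  then have "spectral_map n w a l = 0" for l
    by (simp add: spectral_map_def)
  then have "spectral_map n w a = (\<lambda>_. 0)" by blast
  with True show ?thesis by simp
next
  case False
  have "(\<Sum>j<n. w j) \<noteq> 0"
  proof
    assume "(\<Sum>j<n. w j) = 0"
    then have "w j = 0" if "j < n" for j
      using that w by (subst (asm) sum_nonneg_eq_0_iff) auto
    with False show False by simp
  qed
  with False show ?thesis
    unfolding CARAT_DERIV
    by (intro exI[of _ "\<lambda>l. (\<Sum>j<n. (w j)\<^sup>2 * a j / (1 + l * w j)\<^sup>2) / (\<Sum>j<n. w j * a j / (1 + l * w j)\<^sup>2)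
       * ((\<Sum>j<n. 1 / (1 + l * w j)) / (\<Sum>j<n. w j / (1 + l * w j)))"])
      (auto simp: spectral_map_def mult.commute intro!: continuous_intros)
qed

lemma eventually_resolvent_nonzero:
  fixes w :: "nat \<Rightarrow> real"
  shows "\<forall>\<^sub>F l in nhds 0. \<forall>j<n. 1 + l * w j \<noteq> 0"
proof -
  have "\<forall>\<^sub>F l in nhds 0. 1 + l * w j \<noteq> 0" for j
  proof -
    have "((\<lambda>l. 1 + l * w j) \<longlongrightarrow> 1 + 0 * w j) (nhds 0)"
      by (intro tendsto_intros filterlim_ident)
    then have "\<forall>\<^sub>F l in nhds 0. 0 < 1 + l * w j"
      by (rule order_tendstoD(1)) simp
    then show ?thesis
      by eventually_elim simp
  qed
  then have "\<forall>\<^sub>F l in nhds 0. \<forall>j\<in>{..<n}. 1 + l * w j \<noteq> 0"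
    by (intro eventually_ball_finite) auto
  then show ?thesis by (rule eventually_mono) simp
qed

section \<open>Stability\<close>

text \<open>Close to \<open>x\<close> the difference quotients stay below some \<open>q < 1\<close>, so each iteration shrinks the distance to
\<open>x\<close> by the factor \<open>q\<close> and never leaves the neighbourhood.\<close>

lemma stable_fixed_point_of_deriv:
  fixes g :: "real \<Rightarrow> real"
  assumes fix_x: "fixed_point g x" and deriv: "(g has_real_derivative d) (at x)" and d: "\<bar>d\<bar> < 1"
  shows "stable_fixed_point g x"
proof -
  obtain q where q: "\<bar>d\<bar> < q" "q < 1" using dense[OF d] by blast
  have gx: "g x = x" using fix_x by (simp add: fixed_point_def)
  have "((\<lambda>y. \<bar>(g y - g x) / (y - x)\<bar>) \<longlongrightarrow> \<bar>d\<bar>) (at x)"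
    using deriv unfolding has_field_derivative_iff by (rule tendsto_rabs)
  from order_tendstoD(2)[OF this q(1)]
  obtain e where e: "e > 0" and contr: "\<And>y. y \<noteq> x \<Longrightarrow> dist y x < e \<Longrightarrow> \<bar>(g y - g x) / (y - x)\<bar> < q"
    unfolding eventually_at by auto
  have contr: "\<bar>g y - x\<bar> \<le> q * \<bar>y - x\<bar>" if "\<bar>y - x\<bar> < e" for y
  proof (cases "y = x")
    case False
    then show ?thesis using contr[of y] that by (simp add: dist_real_def gx abs_divide divide_less_eq)
  qed (simp add: gx)
  have "(\<lambda>k. (g ^^ k) y) \<longlonglongrightarrow> x" if y: "\<bar>y - x\<bar> < e" for y
  proof -
    have bound: "\<bar>(g ^^ k) y - x\<bar> \<le> q ^ k * \<bar>y - x\<bar>" for k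
    proof (induction k)
      case (Suc k)
      have "q ^ k * \<bar>y - x\<bar> \<le> 1 * \<bar>y - x\<bar>"
        using q by (intro mult_right_mono power_le_one) auto
      also have "\<dots> < e" using y by simp
      finally have "\<bar>(g ^^ k) y - x\<bar> < e" using Suc by (rule le_less_trans[rotated])
      from contr[OF this] have "\<bar>(g ^^ Suc k) y - x\<bar> \<le> q * \<bar>(g ^^ k) y - x\<bar>" by simp
      also have "\<dots> \<le> q * (q ^ k * \<bar>y - x\<bar>)" using q Suc by (intro mult_left_mono) auto
      finally show ?case by (simp add: mult_ac)
    qed simp
    have "(\<lambda>k. q ^ k * \<bar>y - x\<bar>) \<longlonglongrightarrow> 0 * \<bar>y - x\<bar>"
      using q by (intro tendsto_intros LIMSEQ_realpow_zero) auto
    then have "(\<lambda>k. q ^ k * \<bar>y - x\<bar>) \<longlonglongrightarrow> 0" by simp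
    then have "(\<lambda>k. \<bar>(g ^^ k) y - x\<bar>) \<longlonglongrightarrow> 0"
      by (rule tendsto_sandwich[rotated 3, where f = "\<lambda>_. 0"])
        (use bound in \<open>auto intro!: always_eventually\<close>)
    then have "(\<lambda>k. (g ^^ k) y - x) \<longlonglongrightarrow> 0"
      by (rule tendsto_rabs_zero_cancel)
    then show ?thesis by (simp add: LIM_zero_iff)
  qed
  then have "\<forall>\<^sub>F y in nhds x. (\<lambda>k. (g ^^ k) y) \<longlonglongrightarrow> x"
    using e unfolding eventually_nhds_metric by (auto simp: dist_real_def)
  then show ?thesis using fix_x by (simp add: stable_fixed_point_def)
qed

section \<open>Growth at infinity\<close>

lemma lessThan_eq_insert_zero: "0 < n \<Longrightarrow> {..<n} = insert 0 {1..<n}" for n :: nat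
  by auto

text \<open>Only the mode \<open>0\<close> is in the kernel. It contributes nothing to the three sums weighted by \<open>w\<close>, and the
constant \<open>1\<close> to the trace of the resolvent. In the other modes the powers of \<open>l\<close> can be absorbed into the
bounded filter factors \<open>l w\<^sub>j / (1 + l w\<^sub>j)\<close>, which tend to \<open>1\<close>.\<close>

lemma spectral_map_asymptotics:
  assumes n: "n > 1" and w0: "w 0 = 0" and w: "\<And>j. j \<in> {1..<n} \<Longrightarrow> w j > 0"
    and a: "(\<Sum>j=1..<n. a j / w j) \<noteq> 0"
  shows "((\<lambda>l. spectral_map n w a l / l\<^sup>2) \<longlongrightarrow>
    (\<Sum>j=1..<n. a j) / ((real n - 1) * (\<Sum>j=1..<n. a j / w j))) at_top"
proof -
  define p where "p = (\<lambda>j l. l * w j / (1 + l * w j))"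
  have inv: "((\<lambda>l. 1 / (1 + l * w j)) \<longlongrightarrow> 0) at_top" if "j \<in> {1..<n}" for j
    by (intro tendsto_divide_0[OF tendsto_const] filterlim_at_top_imp_at_infinity
        filterlim_tendsto_add_at_top[OF tendsto_const]
        filterlim_at_top_mult_tendsto_pos[OF tendsto_const w[OF that] filterlim_ident])
  have p: "(p j \<longlongrightarrow> 1) at_top" if j: "j \<in> {1..<n}" for j
  proof (rule Lim_transform_eventually)
    show "((\<lambda>l. 1 - 1 / (1 + l * w j)) \<longlongrightarrow> 1) at_top"
      using tendsto_diff[OF tendsto_const[of 1] inv[OF j]] by simp
    show "\<forall>\<^sub>F l in at_top. 1 - 1 / (1 + l * w j) = p j l"
      using eventually_gt_at_top[of 0]
    proof eventually_elim
      case (elim l)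
      then have "1 + l * w j > 0" using w[OF j] by (simp add: add_pos_pos)
      then show ?case by (simp add: p_def field_simps)
    qed
  qed
  \<comment> \<open>This is the map divided by \<open>l\<^sup>2\<close>, rewritten so that every sum has a finite limit.\<close>
  have "((\<lambda>l. (\<Sum>j=1..<n. (p j l)\<^sup>2 * a j) / (\<Sum>j=1..<n. (p j l)\<^sup>2 * (a j / w j))
      * ((1 + (\<Sum>j=1..<n. 1 / (1 + l * w j))) / (\<Sum>j=1..<n. p j l))) \<longlongrightarrow>
      (\<Sum>j=1..<n. 1\<^sup>2 * a j) / (\<Sum>j=1..<n. 1\<^sup>2 * (a j / w j))
      * ((1 + (\<Sum>j=1..<n. 0)) / (\<Sum>j=1..<n. 1))) at_top"
    using a n by (intro tendsto_intros p inv) auto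
  then have lim: "((\<lambda>l. (\<Sum>j=1..<n. (p j l)\<^sup>2 * a j) / (\<Sum>j=1..<n. (p j l)\<^sup>2 * (a j / w j))
      * ((1 + (\<Sum>j=1..<n. 1 / (1 + l * w j))) / (\<Sum>j=1..<n. p j l))) \<longlongrightarrow>
      (\<Sum>j=1..<n. a j) / ((real n - 1) * (\<Sum>j=1..<n. a j / w j))) at_top"
    using n by (simp add: of_nat_diff mult.commute)
  show ?thesis
  proof (rule Lim_transform_eventually[OF lim])
    show "\<forall>\<^sub>F l in at_top. (\<Sum>j=1..<n. (p j l)\<^sup>2 * a j) / (\<Sum>j=1..<n. (p j l)\<^sup>2 * (a j / w j))
      * ((1 + (\<Sum>j=1..<n. 1 / (1 + l * w j))) / (\<Sum>j=1..<n. p j l)) = spectral_map n w a l / l\<^sup>2"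
      using eventually_gt_at_top[of 0]
    proof eventually_elim
      case (elim l)
      have num: "(\<Sum>j=1..<n. (p j l)\<^sup>2 * a j) = l\<^sup>2 * (\<Sum>j<n. (w j)\<^sup>2 * a j / (1 + l * w j)\<^sup>2)"
        using n by (simp add: lessThan_eq_insert_zero w0 p_def sum_distrib_left power_divide power_mult_distrib mult_ac)
      have "(p j l)\<^sup>2 * (a j / w j) = l\<^sup>2 * (w j * a j / (1 + l * w j)\<^sup>2)" if "j \<in> {1..<n}" for j
        using w[OF that] by (simp add: p_def power_divide power_mult_distrib power2_eq_square[of "w j"])
      then have den: "(\<Sum>j=1..<n. (p j l)\<^sup>2 * (a j / w j)) = l\<^sup>2 * (\<Sum>j<n. w j * a j / (1 + l * w j)\<^sup>2)"
        using n by (simp add: lessThan_eq_insert_zero w0 sum_distrib_left)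
      have tr: "1 + (\<Sum>j=1..<n. 1 / (1 + l * w j)) = (\<Sum>j<n. 1 / (1 + l * w j))"
        using n by (simp add: lessThan_eq_insert_zero w0)
      have trw: "(\<Sum>j=1..<n. p j l) = l * (\<Sum>j<n. w j / (1 + l * w j))"
        using n by (simp add: lessThan_eq_insert_zero w0 p_def sum_distrib_left)
      show ?case
        unfolding num den tr trw spectral_map_def using elim by (simp add: power2_eq_square)
    qed
  qed
qed

text \<open>A weighted harmonic mean lies between any two positive bounds on the averaged values. Positive total weight
also makes its denominator positive.\<close>

lemma harmonic_mean_bounds:
  fixes a w :: "'i \<Rightarrow> real"
  assumes a: "\<And>j. j \<in> A \<Longrightarrow> a j \<ge> 0" and pos: "(\<Sum>j\<in>A. a j) > 0"
    and m: "m > 0" and w: "\<And>j. j \<in> A \<Longrightarrow> m \<le> w j \<and> w j \<le> M"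
  shows "(\<Sum>j\<in>A. a j / w j) > 0"
    and "m \<le> (\<Sum>j\<in>A. a j) / (\<Sum>j\<in>A. a j / w j)"
    and "(\<Sum>j\<in>A. a j) / (\<Sum>j\<in>A. a j / w j) \<le> M"
proof -
  have wp: "w j > 0" if "j \<in> A" for j using w[OF that] m by linarith
  have "A \<noteq> {}" using pos by auto
  then have M: "M > 0" using w wp by (meson all_not_in_conv less_le_trans)
  have "(\<Sum>j\<in>A. m * (a j / w j)) \<le> (\<Sum>j\<in>A. a j)"
  proof (rule sum_mono)
    fix j assume j: "j \<in> A"
    have "m * a j \<le> w j * a j" using w[OF j] a[OF j] by (intro mult_right_mono) auto
    then show "m * (a j / w j) \<le> a j" using wp[OF j] by (simp add: divide_le_eq mult.commute)
  qed
  then have lo: "m * (\<Sum>j\<in>A. a j / w j) \<le> (\<Sum>j\<in>A. a j)" by (simp add: sum_distrib_left)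
  have "(\<Sum>j\<in>A. a j) \<le> (\<Sum>j\<in>A. M * (a j / w j))"
  proof (rule sum_mono)
    fix j assume j: "j \<in> A"
    have "w j * a j \<le> M * a j" using w[OF j] a[OF j] by (intro mult_right_mono) auto
    then show "a j \<le> M * (a j / w j)" using wp[OF j] by (simp add: le_divide_eq mult.commute)
  qed
  then have hi: "(\<Sum>j\<in>A. a j) \<le> M * (\<Sum>j\<in>A. a j / w j)" by (simp add: sum_distrib_left)
  from hi pos have "0 < M * (\<Sum>j\<in>A. a j / w j)" by linarith
  then show S: "(\<Sum>j\<in>A. a j / w j) > 0" using M by (simp add: zero_less_mult_iff)
  show "m \<le> (\<Sum>j\<in>A. a j) / (\<Sum>j\<in>A. a j / w j)" using lo S by (simp add: le_divide_eq)
  show "(\<Sum>j\<in>A. a j) / (\<Sum>j\<in>A. a j / w j) \<le> M" using hi S by (simp add: divide_le_eq)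
qed

section \<open>The spectrum of the circulant finite differences\<close>

lemma fwd_diff_carrier [simp]: "fwd_diff n \<in> carrier_mat n n"
  by (simp add: fwd_diff_def)

lemma fin_diff_carrier [simp]: "fin_diff n r \<in> carrier_mat n n"
  by (simp add: fin_diff_def)

text \<open>A cyclic shift multiplies the Fourier mode \<open>k \<mapsto> z\<^sup>k\<close> by \<open>z\<close>. The wrap-around at \<open>k = n - 1\<close> is harmless
because \<open>z\<^sup>n = 1\<close>.\<close>

lemma fwd_diff_idft:
  assumes n: "n > 0"
  shows "cmat (fwd_diff n) * idft n = idft n * mat_diag n (\<lambda>j. cis (2 * pi * real j / real n) - 1)"
proof (rule eq_matI)
  fix k l assume "k < dim_row (idft n * mat_diag n (\<lambda>j. cis (2 * pi * real j / real n) - 1))"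
    "l < dim_col (idft n * mat_diag n (\<lambda>j. cis (2 * pi * real j / real n) - 1))"
  then have kl: "k < n" "l < n" by (auto simp: idft_def mat_diag_def)
  define z where "z = cis (2 * pi * real l / real n)"
  have zn: "z ^ n = 1" using n by (simp add: z_def DeMoivre cis_multiple_2pi)
  have idft: "idft n $$ (m, l) = z ^ m / complex_of_real (sqrt (real n))" if "m < n" for m
    using that kl exp_root_unity_cis(1)[of l m n] unfolding idft_def z_def by (simp add: mult_ac)
  have zk: "z ^ ((k + 1) mod n) = z ^ (k + 1)"
    by (metis div_mult_mod_eq mult.commute mult_1 power_add power_mult power_one zn)
  have k1: "(k + 1) mod n < n" using n by simp
  have "(cmat (fwd_diff n) * idft n) $$ (k, l)
      = (\<Sum>m<n. complex_of_real (fwd_diff n $$ (k, m)) * idft n $$ (m, l))"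
    using kl by (simp add: fwd_diff_def idft_def scalar_prod_def atLeast0LessThan)
  also have "\<dots> = (\<Sum>m<n. (if m = (k + 1) mod n then idft n $$ (m, l) else 0))
      - (\<Sum>m<n. (if m = k then idft n $$ (m, l) else 0))"
    unfolding sum_subtractf[symmetric] using kl by (intro sum.cong) (auto simp: fwd_diff_def)
  also have "\<dots> = idft n $$ ((k + 1) mod n, l) - idft n $$ (k, l)"
    using kl k1 by simp
  also have "\<dots> = idft n $$ (k, l) * (z - 1)"
    by (simp only: idft[OF k1] idft[OF kl(1)] zk) (simp add: diff_divide_distrib left_diff_distrib mult.commute)
  also have "\<dots> = (idft n * mat_diag n (\<lambda>j. cis (2 * pi * real j / real n) - 1)) $$ (k, l)"
    using kl by (simp add: mat_diag_mult_right[OF idft_carrier] z_def)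
  finally show "(cmat (fwd_diff n) * idft n) $$ (k, l)
    = (idft n * mat_diag n (\<lambda>j. cis (2 * pi * real j / real n) - 1)) $$ (k, l)" .
qed (auto simp: fwd_diff_def idft_def mat_diag_def)

lemma fin_diff_idft:
  assumes n: "n > 0"
  shows "cmat (fin_diff n r) * idft n
    = idft n * mat_diag n (\<lambda>j. (cis (2 * pi * real j / real n) - 1) ^ r)"
proof (induction r)
  case 0
  have "cmat (1\<^sub>m n) = 1\<^sub>m n" by (rule eq_matI) auto
  moreover have "dim_row (fwd_diff n) = n" by (simp add: fwd_diff_def)
  ultimately show ?case by (simp add: fin_diff_def left_mult_one_mat[OF idft_carrier] right_mult_one_mat[OF idft_carrier])
next
  case (Suc r)
  define g where "g = (\<lambda>j. cis (2 * pi * real j / real n) - 1)"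
  have F: "cmat (fwd_diff n) \<in> carrier_mat n n" "cmat (fin_diff n r) \<in> carrier_mat n n" by simp_all
  have "cmat (fin_diff n (Suc r)) * idft n = cmat (fin_diff n r) * cmat (fwd_diff n) * idft n"
    unfolding fin_diff_def pow_mat.simps
    by (subst of_real_hom.mat_hom_mult[of _ n n _ n]) (simp_all add: fin_diff_def[symmetric])
  also have "\<dots> = cmat (fin_diff n r) * (cmat (fwd_diff n) * idft n)"
    by (rule assoc_mult_mat[OF F(2,1) idft_carrier])
  also have "\<dots> = cmat (fin_diff n r) * idft n * mat_diag n g"
    unfolding fwd_diff_idft[OF n] g_def
    by (rule assoc_mult_mat[symmetric, OF F(2) idft_carrier mat_diag_dim])
  also have "\<dots> = idft n * (mat_diag n (\<lambda>j. g j ^ r) * mat_diag n g)"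
    unfolding Suc g_def by (rule assoc_mult_mat[OF idft_carrier mat_diag_dim mat_diag_dim])
  finally show ?case by (simp add: g_def mult.commute)
qed

lemma cmod_cis_minus_one: "(cmod (cis (2 * t) - 1))\<^sup>2 = 4 * (sin t)\<^sup>2"
proof -
  have "(cmod (cis (2 * t) - 1))\<^sup>2 = (cos (2 * t) - 1)\<^sup>2 + (sin (2 * t))\<^sup>2"
    by (simp add: cmod_power2)
  also have "\<dots> = 2 - 2 * cos (2 * t)"
    using sin_cos_squared_add[of "2 * t"] by (simp add: power2_eq_square algebra_simps)
  also have "\<dots> = 4 * (sin t)\<^sup>2"
    by (simp add: cos_double_sin)
  finally show ?thesis .
qed

lemma fin_diff_eigval_sq:
  assumes j: "j < n"
  shows "(cmod (dft_eigval n (fin_diff n r) j))\<^sup>2 = 4 ^ r * sin (pi * real j / real n) ^ (2 * r)"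
proof -
  have n: "n > 0" using j by simp
  have "dft_eigval n (fin_diff n r) j = (cis (2 * pi * real j / real n) - 1) ^ r"
    by (rule dft_eigval_eqI[OF n fin_diff_carrier fin_diff_idft[OF n] j])
  then have "(cmod (dft_eigval n (fin_diff n r) j))\<^sup>2 = ((cmod (cis (2 * (pi * real j / real n)) - 1))\<^sup>2) ^ r"
    by (simp add: norm_power power_mult[symmetric] mult_ac)
  then show ?thesis
    by (simp only: cmod_cis_minus_one power_mult_distrib power_mult)
qed

text \<open>The sine increases on \<open>[0, \<pi>/2]\<close>; modes beyond \<open>n/2\<close> are reflected back by \<open>sin (\<pi> - x) = sin x\<close>.\<close>

lemma sin_pi_fraction_bound:
  assumes "1 \<le> j" "j < n"
  shows "sin (pi / real n) \<le> sin (pi * real j / real n)"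
proof (cases "2 * j \<le> n")
  case True
  then have "pi * real j / real n \<le> pi / 2" using assms by (simp add: field_simps)
  moreover have "pi / real n \<le> pi * real j / real n" using assms by (simp add: divide_right_mono)
  moreover have "0 \<le> pi / real n" by simp
  ultimately show ?thesis by (intro sin_monotone_2pi_le) (use pi_gt_zero in linarith)+
next
  case False
  have eq: "sin (pi * real j / real n) = sin (pi * (real n - real j) / real n)"
  proof -
    have "pi * (real n - real j) / real n = pi - pi * real j / real n"
      using assms by (simp add: field_simps)
    then show ?thesis by simp
  qed
  have "pi * (real n - real j) / real n \<le> pi / 2" using False assms by (simp add: field_simps)
  moreover have "pi / real n \<le> pi * (real n - real j) / real n"
    using assms by (intro divide_right_mono) auto
  moreover have "0 \<le> pi / real n" by simp
  ultimately show ?thesis unfolding eq by (intro sin_monotone_2pi_le) (use pi_gt_zero in linarith)+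
qed

lemma fin_diff_eigval_sq_bounds:
  assumes j: "j \<in> {1..<n}"
  shows "0 < 4 ^ r * sin (pi / real n) ^ (2 * r)"
    and "4 ^ r * sin (pi / real n) ^ (2 * r) \<le> (cmod (dft_eigval n (fin_diff n r) j))\<^sup>2"
    and "(cmod (dft_eigval n (fin_diff n r) j))\<^sup>2 \<le> 4 ^ r"
proof -
  have pos: "sin (pi / real n) > 0"
    using j by (intro sin_gt_zero) (auto simp: field_simps)
  then show "0 < 4 ^ r * sin (pi / real n) ^ (2 * r)" by simp
  have eq: "(cmod (dft_eigval n (fin_diff n r) j))\<^sup>2 = 4 ^ r * sin (pi * real j / real n) ^ (2 * r)"
    using j by (intro fin_diff_eigval_sq) simp
  show "4 ^ r * sin (pi / real n) ^ (2 * r) \<le> (cmod (dft_eigval n (fin_diff n r) j))\<^sup>2"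
    unfolding eq using pos sin_pi_fraction_bound[of j n] j
    by (intro mult_left_mono power_mono) auto
  have "sin (pi * real j / real n) ^ (2 * r) \<le> 1"
    using sin_pi_fraction_bound[of j n] j pos by (intro power_le_one) auto
  then show "(cmod (dft_eigval n (fin_diff n r) j))\<^sup>2 \<le> 4 ^ r"
    unfolding eq by simp
qed

section \<open>The fixed point map at the identity, at zero and at infinity\<close>

lemma fp_map_identity:
  assumes u: "u \<in> carrier_vec n" and nz: "u \<noteq> 0\<^sub>v n" and l: "l \<noteq> -1"
  shows "fp_map n u (1\<^sub>m n) l = l"
proof -
  have n: "n > 0"
    using u nz by (cases n) (auto intro!: eq_vecI)
  have one: "cmat (1\<^sub>m n) = 1\<^sub>m n" by (rule eq_matI) auto
  have "cmat (1\<^sub>m n) * idft n = idft n * mat_diag n (\<lambda>_. 1)"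
    by (simp add: one left_mult_one_mat[OF idft_carrier] right_mult_one_mat[OF idft_carrier])
  from dft_eigval_eqI[OF n one_carrier_mat this]
  have eig: "dft_eigval n (1\<^sub>m n) j = 1" if "j < n" for j using that .
  have "(\<Sum>j<n. (u $ j)\<^sup>2) \<noteq> 0"
  proof
    assume "(\<Sum>j<n. (u $ j)\<^sup>2) = 0"
    then have "u $ j = 0" if "j < n" for j
      using that by (subst (asm) sum_nonneg_eq_0_iff) auto
    then have "u = 0\<^sub>v n" using u by (intro eq_vecI) auto
    with nz show False ..
  qed
  moreover have "(\<Sum>j<n. (u $ j)\<^sup>2) = (norm2 u)\<^sup>2"
    using u by (simp add: norm2_def sum_nonneg)
  ultimately have a: "(\<Sum>j<n. (cmod (dft_vec n u $ j))\<^sup>2) \<noteq> 0"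
    using norm2_dft_vec[OF u n] by simp
  have "fp_map n u (1\<^sub>m n) l = spectral_map n (\<lambda>j. (cmod (dft_eigval n (1\<^sub>m n) j))\<^sup>2)
      (\<lambda>j. (cmod (dft_vec n u $ j))\<^sup>2) l"
    using l by (intro fp_map_eq_spectral_map) (simp add: eig add_eq_0_iff)
  also have "\<dots> = spectral_map n (\<lambda>_. 1) (\<lambda>j. (cmod (dft_vec n u $ j))\<^sup>2) l"
    by (rule spectral_map_cong) (simp add: eig)
  also have "\<dots> = l" by (rule spectral_map_one[OF l a])
  finally show ?thesis .
qed

lemma fp_map_zero_fixed: "fixed_point (fp_map n u T) 0"
  by (simp add: fixed_point_def fp_map_def)

text \<open>Near \<open>0\<close> there are no poles, so the derivative is that of the rational function; the sums over modes are
norms by Parseval.\<close>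

lemma fp_map_deriv_zero:
  assumes n: "n > 0" and u: "u \<in> carrier_vec n" and T: "circulant n T"
  shows "(fp_map n u T has_real_derivative
    real n / (\<Sum>j<n. (cmod (dft_eigval n T j))\<^sup>2)
      * ((norm2 (transpose_mat T *\<^sub>v (T *\<^sub>v u)))\<^sup>2 / (norm2 (T *\<^sub>v u))\<^sup>2)) (at 0)"
proof -
  have Tc: "T \<in> carrier_mat n n" using T by (auto simp: circulant_def)
  have dec: "cmat T = idft n * mat_diag n (dft_eigval n T) * dft n"
    using circulant_dft_decomposition[OF n T] by (simp add: mat_inv_dft[OF n] Lam_def)
  have ev: "\<forall>\<^sub>F l in nhds 0. fp_map n u T l = spectral_map n (\<lambda>j. (cmod (dft_eigval n T j))\<^sup>2)
      (\<lambda>j. (cmod (dft_vec n u $ j))\<^sup>2) l"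
    using eventually_resolvent_nonzero[of n "\<lambda>j. (cmod (dft_eigval n T j))\<^sup>2"]
    by eventually_elim (rule fp_map_eq_spectral_map, blast)
  show ?thesis
    unfolding DERIV_cong_ev[OF refl ev refl] norm2_diagonalized[OF n Tc u dec]
      norm2_transpose_diagonalized[OF n Tc u dec]
    by (rule spectral_map_deriv_zero) auto
qed

text \<open>If all the energy of \<open>u\<close> were in the constant mode, which every difference of positive order kills, then
\<open>T\<^sub>r u\<close> would vanish. For \<open>n = 1\<close> there is no other mode, so this also forces \<open>n > 1\<close>.\<close>

lemma fin_diff_nonconstant_energy:
  assumes n: "n > 0" and u: "u \<in> carrier_vec n" and r: "r > 0"
    and nz: "fin_diff n r *\<^sub>v u \<noteq> 0\<^sub>v n"
  shows "n > 1" and "(\<Sum>j=1..<n. (cmod (dft_vec n u $ j))\<^sup>2) > 0"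
proof -
  let ?a = "\<lambda>j. (cmod (dft_vec n u $ j))\<^sup>2" and ?D = "fin_diff n r"
  have Dc: "?D *\<^sub>v u \<in> carrier_vec n" using u by (intro mult_mat_vec_carrier[of _ n n]) auto
  have e0: "(cmod (dft_eigval n ?D 0))\<^sup>2 = 0"
    using fin_diff_eigval_sq[of 0 n r] n r by simp
  show pos: "(\<Sum>j=1..<n. ?a j) > 0"
  proof (rule ccontr)
    assume "\<not> ?thesis"
    then have "(\<Sum>j=1..<n. ?a j) = 0"
      using sum_nonneg[of "{1..<n}" ?a] by simp
    then have "?a j = 0" if "j \<in> {1..<n}" for j
      using that by (subst (asm) sum_nonneg_eq_0_iff) auto
    then have "(norm2 (?D *\<^sub>v u))\<^sup>2 = 0"
      unfolding norm2_diagonalized[OF n fin_diff_carrier u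
          diagonalized_by_dft[OF n fin_diff_carrier fin_diff_idft[OF n]]]
      using e0 by (simp add: lessThan_eq_insert_zero[OF n])
    then have "(\<Sum>j<n. ((?D *\<^sub>v u) $ j)\<^sup>2) = 0"
      using carrier_vecD[OF Dc] by (simp add: norm2_def sum_nonneg del: dim_mult_mat_vec index_mult_mat_vec)
    then have "(?D *\<^sub>v u) $ j = 0" if "j < n" for j
      using that by (subst (asm) sum_nonneg_eq_0_iff) auto
    then have "?D *\<^sub>v u = 0\<^sub>v n"
      using carrier_vecD[OF Dc] by (intro eq_vecI) (auto simp del: dim_mult_mat_vec index_mult_mat_vec)
    with nz show False ..
  qed
  show "n > 1" by (rule ccontr) (use pos in auto)
qed

text \<open>The constant is \<open>1 / (n - 1)\<close> times the harmonic mean of the squared eigenvalue moduli of the nonconstant modes. The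
positivity of its denominator is recorded because it makes the constant a genuine nonzero limit.\<close>

lemma kappa_inf_bounds:
  assumes n: "n > 1" and a: "(\<Sum>j=1..<n. (cmod (dft_vec n u $ j))\<^sup>2) > 0"
  shows "(\<Sum>j=1..<n. (cmod (dft_vec n u $ j))\<^sup>2 / (cmod (dft_eigval n (fin_diff n r) j))\<^sup>2) > 0"
    and "4 ^ r * sin (pi / real n) ^ (2 * r) / (real n - 1) \<le> kappa_inf n u (fin_diff n r)"
    and "kappa_inf n u (fin_diff n r) \<le> 4 ^ r / (real n - 1)"
proof -
  have one: "1 \<in> {1..<n}" using n by simp
  note hm = harmonic_mean_bounds[where A = "{1..<n}" and a = "\<lambda>j. (cmod (dft_vec n u $ j))\<^sup>2"
      and w = "\<lambda>j. (cmod (dft_eigval n (fin_diff n r) j))\<^sup>2" and M = "4 ^ r",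
      OF _ a fin_diff_eigval_sq_bounds(1)[OF one]]
  show "(\<Sum>j=1..<n. (cmod (dft_vec n u $ j))\<^sup>2 / (cmod (dft_eigval n (fin_diff n r) j))\<^sup>2) > 0"
    by (rule hm) (use fin_diff_eigval_sq_bounds(2,3) in auto)
  have kappa: "kappa_inf n u (fin_diff n r) = (\<Sum>j=1..<n. (cmod (dft_vec n u $ j))\<^sup>2)
      / (\<Sum>j=1..<n. (cmod (dft_vec n u $ j))\<^sup>2 / (cmod (dft_eigval n (fin_diff n r) j))\<^sup>2) / (real n - 1)"
    by (simp add: kappa_inf_def mult.commute)
  show "4 ^ r * sin (pi / real n) ^ (2 * r) / (real n - 1) \<le> kappa_inf n u (fin_diff n r)"
    unfolding kappa
    by (intro divide_right_mono hm) (use fin_diff_eigval_sq_bounds(2,3) n in auto)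
  show "kappa_inf n u (fin_diff n r) \<le> 4 ^ r / (real n - 1)"
    unfolding kappa
    by (intro divide_right_mono hm) (use fin_diff_eigval_sq_bounds(2,3) n in auto)
qed

lemma fp_map_fin_diff_asymptotics:
  assumes n: "n > 1" and r: "r > 0" and a: "(\<Sum>j=1..<n. (cmod (dft_vec n u $ j))\<^sup>2) > 0"
  shows "((\<lambda>l. fp_map n u (fin_diff n r) l / (l\<^sup>2 * kappa_inf n u (fin_diff n r))) \<longlongrightarrow> 1) at_top"
proof -
  let ?w = "\<lambda>j. (cmod (dft_eigval n (fin_diff n r) j))\<^sup>2" and ?a = "\<lambda>j. (cmod (dft_vec n u $ j))\<^sup>2"
  let ?k = "kappa_inf n u (fin_diff n r)"
  have w0: "?w 0 = 0" using fin_diff_eigval_sq[of 0 n r] n r by simp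
  have w: "?w j > 0" if "j \<in> {1..<n}" for j
    using fin_diff_eigval_sq_bounds(1,2)[OF that, of r] by linarith
  have S: "(\<Sum>j=1..<n. ?a j / ?w j) > 0" by (rule kappa_inf_bounds(1)[OF n a])
  have k: "?k > 0" using a S n unfolding kappa_inf_def by (intro divide_pos_pos mult_pos_pos) auto
  have "((\<lambda>l. spectral_map n ?w ?a l / l\<^sup>2) \<longlongrightarrow> ?k) at_top"
    unfolding kappa_inf_def
    by (rule spectral_map_asymptotics[where w = ?w, OF n w0 w less_imp_neq[OF S, symmetric]])
  then have "((\<lambda>l. spectral_map n ?w ?a l / l\<^sup>2 / ?k) \<longlongrightarrow> ?k / ?k) at_top"
    using k by (intro tendsto_divide tendsto_const) auto
  then have lim: "((\<lambda>l. spectral_map n ?w ?a l / l\<^sup>2 / ?k) \<longlongrightarrow> 1) at_top"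
    using k by simp
  show ?thesis
  proof (rule Lim_transform_eventually[OF lim])
    show "\<forall>\<^sub>F l in at_top. spectral_map n ?w ?a l / l\<^sup>2 / ?k = fp_map n u (fin_diff n r) l / (l\<^sup>2 * ?k)"
      using eventually_gt_at_top[of 0]
    proof eventually_elim
      case (elim l)
      have "1 + l * ?w j \<noteq> 0" for j
      proof -
        have "l * ?w j \<ge> 0" using elim by simp
        then show ?thesis by linarith
      qed
      then show ?case by (simp add: fp_map_eq_spectral_map)
    qed
  qed
qed

theorem proposition2:
  fixes n :: nat and u :: "real vec" and T :: "real mat"
  assumes u: "u \<in> carrier_vec n"
    and u_nonzero: "u \<noteq> 0\<^sub>v n"
    and T: "circulant n T"
  shows
    "((\<forall>l. l \<noteq> -1 \<longrightarrow> fp_map n u (1\<^sub>m n) l = l \<and> fixed_point (fp_map n u (1\<^sub>m n)) l) \<and>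
      (fp_map n u (1\<^sub>m n) \<longlongrightarrow> -1) (at (-1)))
     \<and>
     (fixed_point (fp_map n u T) 0 \<and>
      (let d = real n / (\<Sum>j<n. (cmod (dft_eigval n T j))\<^sup>2)
               * ((norm2 (transpose_mat T *\<^sub>v (T *\<^sub>v u)))\<^sup>2 / (norm2 (T *\<^sub>v u))\<^sup>2)
       in (fp_map n u T has_real_derivative d) (at 0) \<and>
          (d < 1 \<longrightarrow> stable_fixed_point (fp_map n u T) 0)))
     \<and>
     (\<forall>r::nat. r > 0 \<longrightarrow> fin_diff n r *\<^sub>v u \<noteq> 0\<^sub>v n \<longrightarrow>
        ((\<lambda>l. fp_map n u (fin_diff n r) l / (l\<^sup>2 * kappa_inf n u (fin_diff n r))) \<longlongrightarrow> 1) at_top \<and>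
        4 ^ r * sin (pi / real n) ^ (2 * r) / (real n - 1) \<le> kappa_inf n u (fin_diff n r) \<and>
        kappa_inf n u (fin_diff n r) \<le> 4 ^ r / (real n - 1))"
proof -
  have n: "n > 0"
    using u u_nonzero by (cases n) (auto intro!: eq_vecI)
  let ?d = "real n / (\<Sum>j<n. (cmod (dft_eigval n T j))\<^sup>2)
    * ((norm2 (transpose_mat T *\<^sub>v (T *\<^sub>v u)))\<^sup>2 / (norm2 (T *\<^sub>v u))\<^sup>2)"
  \<comment> \<open>\<open>-1\<close> is the only pole for the identity, so the map agrees with \<open>l\<close> on a punctured neighbourhood of it.\<close>
  have "((\<lambda>l. l) \<longlongrightarrow> - 1) (at (- 1 :: real))" by (rule tendsto_ident_at)
  then have part1: "(fp_map n u (1\<^sub>m n) \<longlongrightarrow> -1) (at (-1))"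
    by (rule Lim_transform_eventually)
      (simp add: eventually_at_filter fp_map_identity[OF u u_nonzero])
  have deriv: "(fp_map n u T has_real_derivative ?d) (at 0)"
    by (rule fp_map_deriv_zero[OF n u T])
  have "0 \<le> ?d" by (intro mult_nonneg_nonneg divide_nonneg_nonneg sum_nonneg) auto
  then have stable: "?d < 1 \<longrightarrow> stable_fixed_point (fp_map n u T) 0"
    using stable_fixed_point_of_deriv[OF fp_map_zero_fixed deriv] by linarith
  have part3: "((\<lambda>l. fp_map n u (fin_diff n r) l / (l\<^sup>2 * kappa_inf n u (fin_diff n r))) \<longlongrightarrow> 1) at_top \<and>
        4 ^ r * sin (pi / real n) ^ (2 * r) / (real n - 1) \<le> kappa_inf n u (fin_diff n r) \<and>
        kappa_inf n u (fin_diff n r) \<le> 4 ^ r / (real n - 1)"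
    if "r > 0" "fin_diff n r *\<^sub>v u \<noteq> 0\<^sub>v n" for r
    using fin_diff_nonconstant_energy[OF n u that] fp_map_fin_diff_asymptotics kappa_inf_bounds(2,3) that(1)
    by blast
  show ?thesis
    unfolding Let_def using part1 fp_map_zero_fixed deriv stable part3
    by (simp add: fp_map_identity[OF u u_nonzero] fixed_point_def)
qed

end
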